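(* Let $G\le\mathrm{Sym}(\Omega)$ be a finite primitive permutation group which is not almost simple. Then $\kappa(G)=1$ if and only if $G$ is sharply $2$-transitive.
   Context: A derangement is an element of $G$ fixing no point of $\Omega$; $\kappa(G)$ is the number of conjugacy classes of $G$ consisting of derangements. $G$ is sharply $2$-transitive if it acts regularly on ordered pairs of distinct points of $\Omega$. *)

theory Defs
  imports "HOL-Algebra.Algebra"
begin

definition perm_group :: "'a set \<Rightarrow> ('a \<Rightarrow> 'a) set \<Rightarrow> bool" where
  "perm_group \<Omega> G \<longleftrightarrow> subgroup G (BijGroup \<Omega>)"

abbreviation PG :: "'a set \<Rightarrow> ('a \<Rightarrow> 'a) set \<Rightarrow> ('a \<Rightarrow> 'a) monoid" where
  "PG \<Omega> G \<equiv> (BijGroup \<Omega>)\<lparr>carrier := G\<rparr>"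

definition transitive_on :: "'a set \<Rightarrow> ('a \<Rightarrow> 'a) set \<Rightarrow> bool" where
  "transitive_on \<Omega> G \<longleftrightarrow> \<Omega> \<noteq> {} \<and> (\<forall>x\<in>\<Omega>. \<forall>y\<in>\<Omega>. \<exists>g\<in>G. g x = y)"

definition is_block :: "'a set \<Rightarrow> ('a \<Rightarrow> 'a) set \<Rightarrow> 'a set \<Rightarrow> bool" where
  "is_block \<Omega> G B \<longleftrightarrow> B \<subseteq> \<Omega> \<and> B \<noteq> {} \<and>
     (\<forall>g\<in>G. g ` B = B \<or> g ` B \<inter> B = {})"

definition primitive :: "'a set \<Rightarrow> ('a \<Rightarrow> 'a) set \<Rightarrow> bool" where
  "primitive \<Omega> G \<longleftrightarrow> transitive_on \<Omega> G \<and>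
     (\<forall>B. is_block \<Omega> G B \<longrightarrow> card B = 1 \<or> B = \<Omega>)"

definition derangement :: "'a set \<Rightarrow> ('a \<Rightarrow> 'a) \<Rightarrow> bool" where
  "derangement \<Omega> g \<longleftrightarrow> (\<forall>x\<in>\<Omega>. g x \<noteq> x)"

definition conj_class :: "('g, 'b) monoid_scheme \<Rightarrow> 'g \<Rightarrow> 'g set" where
  "conj_class H g = {h \<otimes>\<^bsub>H\<^esub> g \<otimes>\<^bsub>H\<^esub> inv\<^bsub>H\<^esub> h | h. h \<in> carrier H}"

definition kappa :: "'a set \<Rightarrow> ('a \<Rightarrow> 'a) set \<Rightarrow> nat" where
  "kappa \<Omega> G = card {C. \<exists>g\<in>G. C = conj_class (PG \<Omega> G) g \<and>
                                 (\<forall>h\<in>C. derangement \<Omega> h)}"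

definition sharply_2_transitive :: "'a set \<Rightarrow> ('a \<Rightarrow> 'a) set \<Rightarrow> bool" where
  "sharply_2_transitive \<Omega> G \<longleftrightarrow>
     (\<exists>x\<in>\<Omega>. \<exists>y\<in>\<Omega>. x \<noteq> y) \<and>
     (\<forall>x\<in>\<Omega>. \<forall>y\<in>\<Omega>. \<forall>x'\<in>\<Omega>. \<forall>y'\<in>\<Omega>. x \<noteq> y \<longrightarrow> x' \<noteq> y' \<longrightarrow>
        (\<exists>!g. g \<in> G \<and> g x = x' \<and> g y = y'))"

text \<open>Almost simple: G has a nonabelian simple normal subgroup T such that the conjugation
  action G \<rightarrow> Aut(T) is faithful, i.e. C_G(T) = 1 (equivalently T \<le> G \<le> Aut(T)).\<close>
definition almost_simple :: "('g, 'b) monoid_scheme \<Rightarrow> bool" where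
  "almost_simple H \<longleftrightarrow> (\<exists>T. T \<lhd> H \<and> simple_group (H\<lparr>carrier := T\<rparr>) \<and>
      \<not> comm_group (H\<lparr>carrier := T\<rparr>) \<and>
      (\<forall>g\<in>carrier H. (\<forall>t\<in>T. g \<otimes>\<^bsub>H\<^esub> t = t \<otimes>\<^bsub>H\<^esub> g) \<longrightarrow> g = \<one>\<^bsub>H\<^esub>))"

end

theory Submission
  imports Defs
begin

text \<open>
  If \<open>G\<close> is sharply 2-transitive of degree \<open>n\<close>, then \<open>|G| = n (n - 1)\<close> and exactly \<open>n - 1\<close> elements
  are derangements. The centralizer of a derangement is semiregular, so has order at most \<open>n\<close>, and
  the class of a derangement has at least \<open>n - 1\<close> elements.

  Conversely let all derangements be conjugate, and let \<open>N\<close> be a minimal normal subgroup. It is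
  transitive. If \<open>N\<close> is abelian, it is regular and its nontrivial elements are the derangements, on
  which \<open>G\<close> acts transitively; sharpness follows by counting fixed points in cosets of \<open>N\<close>.
  Suppose that \<open>N\<close> is nonabelian, and let \<open>T\<close> be minimal normal in \<open>N\<close>. Then \<open>N = T \<times> C\<close> with
  \<open>C\<close> the centralizer of \<open>T\<close> in \<open>N\<close>, every \<open>G\<close>-conjugate of \<open>T\<close> is \<open>T\<close> or lies in \<open>C\<close>, and
  \<open>T\<close> has trivial center. So \<open>T\<close> cannot be semiregular: its nontrivial elements would all be
  conjugate, hence of the same order, and \<open>T\<close> would be a \<open>p\<close>-group.
  If \<open>C = 1\<close>, then \<open>N = T\<close> is simple and, \<open>G\<close> not being almost simple, has a nontrivial
  centralizer in \<open>G\<close>; this is transitive, which makes \<open>T\<close> semiregular.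
  If \<open>C \<noteq> 1\<close>, let \<open>R\<close> be the projection to \<open>T\<close> of a point stabilizer in \<open>N\<close>. If \<open>R = T\<close>, then the
  point stabilizer in \<open>T\<close> is normal in \<open>N\<close>, so again \<open>T\<close> is semiregular. Otherwise some \<open>t \<in> T\<close> is
  not conjugate into \<open>R\<close>, and \<open>t c\<close> is a derangement for each \<open>c \<in> C\<close>; but \<open>t\<close> and \<open>t c\<close> are not
  conjugate when \<open>c \<noteq> 1\<close>.
\<close>

subsection \<open>Conjugation in finite groups\<close>

definition conjug :: "('g, 'b) monoid_scheme \<Rightarrow> 'g \<Rightarrow> 'g \<Rightarrow> 'g" where
  "conjug G g a = g \<otimes>\<^bsub>G\<^esub> a \<otimes>\<^bsub>G\<^esub> inv\<^bsub>G\<^esub> g"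

context group
begin

lemma conjug_closed [simp]:
  "\<lbrakk>g \<in> carrier G; a \<in> carrier G\<rbrakk> \<Longrightarrow> conjug G g a \<in> carrier G"
  by (simp add: conjug_def)

lemma conjug_one [simp]: "g \<in> carrier G \<Longrightarrow> conjug G g \<one> = \<one>"
  by (simp add: conjug_def)

lemma conjug_by_one [simp]: "a \<in> carrier G \<Longrightarrow> conjug G \<one> a = a"
  by (simp add: conjug_def)

lemma conjug_conjug:
  "\<lbrakk>g \<in> carrier G; h \<in> carrier G; a \<in> carrier G\<rbrakk>
    \<Longrightarrow> conjug G g (conjug G h a) = conjug G (g \<otimes> h) a"
  by (simp add: conjug_def m_assoc inv_mult_group)

lemma conjug_inv_cancel [simp]:
  assumes "g \<in> carrier G" "a \<in> carrier G"
  shows "conjug G (inv g) (conjug G g a) = a" and "conjug G g (conjug G (inv g) a) = a"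
  using assms by (simp_all add: conjug_conjug)

lemma conjug_mult:
  assumes "g \<in> carrier G" "a \<in> carrier G" "b \<in> carrier G"
  shows "conjug G g (a \<otimes> b) = conjug G g a \<otimes> conjug G g b"
proof -
  have "inv g \<otimes> (g \<otimes> (b \<otimes> inv g)) = b \<otimes> inv g"
    using assms by (simp flip: m_assoc)
  then show ?thesis
    using assms by (simp add: conjug_def m_assoc)
qed

lemma conjug_pow:
  assumes "g \<in> carrier G" "a \<in> carrier G"
  shows "conjug G g (a [^] (n::nat)) = conjug G g a [^] n"
  using assms by (induction n) (simp_all add: conjug_mult)

lemma conjug_eq_one_iff [simp]:
  assumes "g \<in> carrier G" "a \<in> carrier G"
  shows "conjug G g a = \<one> \<longleftrightarrow> a = \<one>"
  using assms conjug_inv_cancel(1) conjug_one inv_closed by metis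

lemma conjug_eq_self_iff:
  assumes "g \<in> carrier G" "a \<in> carrier G"
  shows "conjug G g a = a \<longleftrightarrow> g \<otimes> a = a \<otimes> g"
  using assms by (simp add: conjug_def inv_solve_right')

lemma conjug_hom: "g \<in> carrier G \<Longrightarrow> group_hom G G (conjug G g)"
  by unfold_locales (auto simp: hom_def conjug_mult)

lemma inj_on_conjug: "\<lbrakk>g \<in> carrier G; A \<subseteq> carrier G\<rbrakk> \<Longrightarrow> inj_on (conjug G g) A"
  by (rule inj_on_inverseI[where g = "conjug G (inv g)"]) auto

lemma subgroup_conjug_image:
  "\<lbrakk>g \<in> carrier G; subgroup H G\<rbrakk> \<Longrightarrow> subgroup (conjug G g ` H) G"
  by (rule group_hom.subgroup_img_is_subgroup[OF conjug_hom])

text \<open>Count the pairs \<open>(s, k)\<close> with \<open>s k s\<^sup>-\<^sup>1 \<in> R\<close>. Each \<open>s\<close> occurs in exactly \<open>|R|\<close> of them;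
  \<open>k = 1\<close> occurs in \<open>|G|\<close>, and every other \<open>k\<close> that is conjugate into \<open>R\<close> in at least \<open>|R|\<close>.\<close>

lemma conjugates_of_proper_subgroup_not_cover:
  assumes fin: "finite (carrier G)" and R: "subgroup R G" and ne: "R \<noteq> carrier G"
  obtains t where "t \<in> carrier G" "\<And>s. s \<in> carrier G \<Longrightarrow> conjug G s t \<notin> R"
proof -
  interpret R: subgroup R G by (rule R)
  have finR: "finite R" using fin R.subset finite_subset by blast
  have "\<exists>t\<in>carrier G. \<forall>s\<in>carrier G. conjug G s t \<notin> R"
  proof (rule ccontr)
    assume "\<not> ?thesis"
    then have cov: "\<And>t. t \<in> carrier G \<Longrightarrow> \<exists>s\<in>carrier G. conjug G s t \<in> R" by blast
    define fiber where "fiber k = {s \<in> carrier G. conjug G s k \<in> R}" for k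
    have fiber_ge: "card R \<le> card (fiber k)" if k: "k \<in> carrier G" for k
    proof -
      obtain s where s: "s \<in> carrier G" "conjug G s k \<in> R" using cov k by blast
      \<comment> \<open>If \<open>s\<close> conjugates \<open>k\<close> into \<open>R\<close>, so
        does every element of the coset \<open>R s\<close>.\<close>
      have "(\<lambda>r. r \<otimes> s) ` R \<subseteq> fiber k"
      proof
        fix y assume "y \<in> (\<lambda>r. r \<otimes> s) ` R"
        then obtain r where r: "r \<in> R" "y = r \<otimes> s" by blast
        have "conjug G y k = conjug G r (conjug G s k)"
          using r s k by (simp add: conjug_conjug)
        also have "\<dots> \<in> R" using r s by (simp add: conjug_def)
        finally show "y \<in> fiber k" using r s by (simp add: fiber_def)
      qed
      moreover have "inj_on (\<lambda>r. r \<otimes> s) R" using s by (auto simp: inj_on_def)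
      moreover have "finite (fiber k)" using fin by (simp add: fiber_def)
      ultimately show ?thesis by (metis card_image card_mono)
    qed
    have fiber_one: "fiber \<one> = carrier G" by (auto simp: fiber_def)
    have "(\<Sum>k\<in>carrier G. card (fiber k)) = card (SIGMA k:carrier G. fiber k)"
      using fin by (simp add: fiber_def)
    also have "\<dots> = card (carrier G \<times> R)"
    proof (rule bij_betw_same_card[of "\<lambda>(k, s). (s, conjug G s k)"])
      show "bij_betw (\<lambda>(k, s). (s, conjug G s k)) (SIGMA k:carrier G. fiber k) (carrier G \<times> R)"
        by (rule bij_betwI[where g = "\<lambda>(s, r). (conjug G (inv s) r, s)"])
          (auto simp: fiber_def)
    qed
    also have "\<dots> = card (carrier G) * card R" by (simp add: card_cartesian_product)
    finally have tot: "(\<Sum>k\<in>carrier G. card (fiber k)) = card (carrier G) * card R" .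
    have "(\<Sum>k\<in>carrier G. card (fiber k))
        = card (carrier G) + (\<Sum>k\<in>carrier G - {\<one>}. card (fiber k))"
      using fin by (simp add: sum.remove[of _ \<one>] fiber_one)
    moreover have "(\<Sum>k\<in>carrier G - {\<one>}. card R) \<le> (\<Sum>k\<in>carrier G - {\<one>}. card (fiber k))"
      by (intro sum_mono fiber_ge) auto
    \<comment> \<open>Cancelling the common term \<open>(card (carrier G) - 1) * card R\<close>
      leaves |G| \<le> |R|, against \<open>R\<close> being proper.\<close>
    ultimately have "card (carrier G) + (card (carrier G) - 1) * card R \<le> card (carrier G) * card R"
      using tot fin by simp
    moreover have "card (carrier G) * card R = card R + (card (carrier G) - 1) * card R"
      using fin by (cases "card (carrier G)") auto
    ultimately have "card (carrier G) \<le> card R" by linarith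
    then show False using fin ne R.subset by (metis card_seteq)
  qed
  then show ?thesis using that by blast
qed

text \<open>The class equation modulo \<open>p\<close>: if only the identity were central, every
  class other than {1} would have size a power of \<open>p\<close> greater than 1, and |G| would be
  1 modulo \<open>p\<close>.\<close>

lemma prime_power_order_center:
  assumes fin: "finite (carrier G)" and p: "Factorial_Ring.prime (p::nat)" and ord: "order G = p ^ n"
    and nt: "carrier G \<noteq> {\<one>}"
  obtains z where "z \<in> carrier G" "z \<noteq> \<one>" "\<And>a. a \<in> carrier G \<Longrightarrow> a \<otimes> z = z \<otimes> a"
proof -
  let ?\<phi> = "\<lambda>g. \<lambda>h\<in>carrier G. g \<otimes> h \<otimes> inv g"
  interpret act: group_action G "carrier G" ?\<phi> by (rule action_by_conjugation)
  have "\<exists>z\<in>carrier G. z \<noteq> \<one> \<and> (\<forall>a\<in>carrier G. a \<otimes> z = z \<otimes> a)"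
  proof (rule ccontr)
    assume none: "\<not> ?thesis"
    let ?O = "orbits G (carrier G) ?\<phi>"
    have orb_eq: "orbit G ?\<phi> x = (\<lambda>g. conjug G g x) ` carrier G" if "x \<in> carrier G" for x
      using that by (auto simp: orbit_def conjug_def)
    have one: "orbit G ?\<phi> \<one> = {\<one>}" by (auto simp: orb_eq)
    have finO: "finite ?O" using fin by (auto simp: orbits_def)
    have oneO: "{\<one>} \<in> ?O" using one by (force simp: orbits_def)
    have p_dvd: "p dvd card C" if C: "C \<in> ?O - {{\<one>}}" for C
    proof -
      obtain x where x: "x \<in> carrier G" "C = orbit G ?\<phi> x" using C by (auto simp: orbits_def)
      have "x \<noteq> \<one>" using x C one by auto
      then obtain a where a: "a \<in> carrier G" "a \<otimes> x \<noteq> x \<otimes> a" using none x by blast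
      then have "conjug G a x \<noteq> x" using x by (simp add: conjug_eq_self_iff)
      moreover have "conjug G a x \<in> C" using a x by (simp add: orb_eq)
      moreover have "x \<in> C" using x act.orbit_refl by simp
      ultimately have "card C \<noteq> 1" by (metis card_1_singletonE singletonD)
      moreover have "card C dvd p ^ n"
        using act.orbit_stabilizer_theorem[OF x(1)] unfolding x(2) ord by (rule dvdI[OF sym])
      then obtain i where "card C = p ^ i" using p by (auto simp: divides_primepow_nat)
      ultimately show ?thesis by (cases i) auto
    qed
    have "order G = (\<Sum>C\<in>?O. card C)"
      using act.disjoint_sum[OF fin, of "\<lambda>_. 1::nat"] by (simp add: order_def)
    also have "\<dots> = 1 + (\<Sum>C\<in>?O - {{\<one>}}. card C)"
      using finO oneO by (simp add: sum.remove)
    finally have "order G = 1 + (\<Sum>C\<in>?O - {{\<one>}}. card C)" .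
    moreover have "p dvd (\<Sum>C\<in>?O - {{\<one>}}. card C)" by (intro dvd_sum p_dvd)
    moreover have "p dvd order G"
    proof -
      have "order G \<noteq> 1"
        using nt order_one_triv_iff by blast
      then show ?thesis using ord by (cases n) auto
    qed
    ultimately have "p dvd 1" by (simp only: dvd_add_left_iff)
    then show False using p by simp
  qed
  then show ?thesis using that by blast
qed

text \<open>Hypothesis \<open>eq\<close> says through exponents that all nontrivial elements have
  the same order. By Sylow, each prime divisor of |G| yields a nontrivial element of order a power
  of that prime. So only one prime divides |G|, and the previous lemma applies.\<close>

lemma equal_orders_center:
  assumes fin: "finite (carrier G)" and nt: "carrier G \<noteq> {\<one>}"
    and eq: "\<And>a b n. \<lbrakk>a \<in> carrier G; b \<in> carrier G; a \<noteq> \<one>; b \<noteq> \<one>; a [^] (n::nat) = \<one>\<rbrakk>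
              \<Longrightarrow> b [^] n = \<one>"
  obtains z where "z \<in> carrier G" "z \<noteq> \<one>" "\<And>a. a \<in> carrier G \<Longrightarrow> a \<otimes> z = z \<otimes> a"
proof -
  have ord1: "order G \<noteq> 1"
    using nt order_one_triv_iff by blast
  have ord0: "order G \<noteq> 0" using fin by (auto simp: order_def)
  have power_elem: "\<exists>a\<in>carrier G. a \<noteq> \<one> \<and> (\<exists>i. a [^] (q ^ i) = \<one>)"
    if q: "Factorial_Ring.prime q" "q dvd order G" for q :: nat
  proof -
    define i where "i = multiplicity q (order G)"
    have "order G = q ^ i * (order G div q ^ i)"
      by (simp add: i_def multiplicity_dvd)
    then obtain Q where Q: "subgroup Q G" "card Q = q ^ i"
      using sylow_thm[OF q(1) is_group] fin by blast
    interpret Q: subgroup Q G by (rule Q)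
    have "i > 0" using q ord0 prime_multiplicity_gt_zero_iff[of q "order G"] unfolding i_def by simp
    then have "q ^ i > 1" using q(1) prime_gt_1_nat one_less_power by blast
    then have "Q \<noteq> {\<one>}" using Q(2) by auto
    then obtain a where a: "a \<in> Q" "a \<noteq> \<one>" using Q.one_closed by blast
    have "a [^]\<^bsub>G\<lparr>carrier := Q\<rparr>\<^esub> order (G\<lparr>carrier := Q\<rparr>) = \<one>\<^bsub>G\<lparr>carrier := Q\<rparr>\<^esub>"
      using a by (intro group.pow_order_eq_1 Q.subgroup_is_group is_group) simp
    then have "a [^] (q ^ i) = \<one>"
      using Q(2) nat_pow_consistent[of a "q ^ i" Q] by (simp add: order_def)
    then show ?thesis using a by auto
  qed
  obtain p where p: "Factorial_Ring.prime p" "p dvd order G" using ord1 prime_factor_nat by blast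
  have uniq: "q = p" if q: "Factorial_Ring.prime q" "q dvd order G" for q
  proof (rule ccontr)
    assume "q \<noteq> p"
    obtain a i where a: "a \<in> carrier G" "a \<noteq> \<one>" "a [^] (p ^ i) = \<one>" using power_elem[OF p] by blast
    obtain b j where b: "b \<in> carrier G" "b \<noteq> \<one>" "b [^] (q ^ j) = \<one>" using power_elem[OF q] by blast
    have "a [^] (q ^ j) = \<one>" using eq[OF b(1) a(1) b(2) a(2) b(3)] .
    then have "ord a dvd q ^ j" "ord a dvd p ^ i" using a pow_eq_id by auto
    moreover have "coprime (q ^ j) (p ^ i)" using \<open>q \<noteq> p\<close> p q by (simp add: primes_coprime)
    ultimately have "ord a = 1" by (metis coprime_common_divisor_nat)
    then show False using a ord_eq_1 by blast
  qed
  have "prime_factors (order G) = {p}"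
    unfolding prime_factors_dvd[OF ord0] using uniq p by blast
  then have "order G = p ^ multiplicity p (order G)"
    using prod_prime_factors[of "order G"] ord0 by simp
  from prime_power_order_center[OF fin p(1) this nt] that show ?thesis by blast
qed

end

subsection \<open>Nonabelian minimal normal subgroups\<close>

text \<open>Normality is taken relative to a set \<open>K\<close> inside one ambient group, so that
  a normal subgroup of a subgroup can be handled without changing the group structure.\<close>

definition normalized_by :: "('g, 'b) monoid_scheme \<Rightarrow> 'g set \<Rightarrow> 'g set \<Rightarrow> bool" where
  "normalized_by G K H \<longleftrightarrow> (\<forall>k\<in>K. \<forall>h\<in>H. conjug G k h \<in> H)"

definition minimal_normal_in :: "('g, 'b) monoid_scheme \<Rightarrow> 'g set \<Rightarrow> 'g set \<Rightarrow> bool" where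
  "minimal_normal_in G K H \<longleftrightarrow>
     subgroup H G \<and> H \<subseteq> K \<and> H \<noteq> {\<one>\<^bsub>G\<^esub>} \<and> normalized_by G K H \<and>
     (\<forall>L. subgroup L G \<longrightarrow> L \<subseteq> H \<longrightarrow> L \<noteq> {\<one>\<^bsub>G\<^esub>} \<longrightarrow> normalized_by G K L \<longrightarrow> L = H)"

context group
begin

lemma normal_iff_normalized: "H \<lhd> G \<longleftrightarrow> subgroup H G \<and> normalized_by G (carrier G) H"
  by (simp add: normal_inv_iff normalized_by_def conjug_def)

lemma subgroup_normalizes_itself: "subgroup K G \<Longrightarrow> normalized_by G K K"
  by (simp add: normalized_by_def conjug_def subgroup.m_closed subgroup.m_inv_closed)

lemma minimal_normal_in_exists:
  assumes fin: "finite (carrier G)" and K: "subgroup K G" "K \<noteq> {\<one>}"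
  obtains H where "minimal_normal_in G K H"
proof -
  let ?P = "\<lambda>H. subgroup H G \<and> H \<subseteq> K \<and> H \<noteq> {\<one>} \<and> normalized_by G K H"
  have "?P K" using K subgroup_normalizes_itself by blast
  then obtain H where H: "?P H" and least: "\<And>L. ?P L \<Longrightarrow> card H \<le> card L"
    using ex_has_least_nat[where P = ?P and k = K and m = card] by metis
  have "minimal_normal_in G K H"
    unfolding minimal_normal_in_def
  proof (intro conjI allI impI)
    fix L assume L: "subgroup L G" "L \<subseteq> H" "L \<noteq> {\<one>}" "normalized_by G K L"
    have "finite H" using H fin by (meson subgroup.subset finite_subset)
    moreover have "card H \<le> card L" using H L by (intro least) auto
    ultimately show "L = H" using L(2) by (metis card_seteq)
  qed (use H in auto)
  then show ?thesis using that by blast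
qed

text \<open>The commutator of \<open>a\<close> and \<open>b\<close>, bracketed in two ways, is seen
  to lie in \<open>A\<close> and in \<open>B\<close>, hence is trivial.\<close>

lemma commute_if_normalized_disjoint:
  assumes A: "subgroup A G" and B: "subgroup B G"
    and nA: "normalized_by G B A" and nB: "normalized_by G A B" and disj: "A \<inter> B \<subseteq> {\<one>}"
    and ab: "a \<in> A" "b \<in> B"
  shows "a \<otimes> b = b \<otimes> a"
proof -
  have [simp]: "a \<in> carrier G" "b \<in> carrier G" using A B ab subgroup.mem_carrier by fast+
  have "a \<otimes> conjug G b (inv a) \<in> A"
    using A nA ab by (simp add: normalized_by_def subgroup.m_closed subgroup.m_inv_closed)
  moreover have "conjug G a b \<otimes> inv b \<in> B"
    using B nB ab by (simp add: normalized_by_def subgroup.m_closed subgroup.m_inv_closed)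
  moreover have "a \<otimes> conjug G b (inv a) = conjug G a b \<otimes> inv b"
    by (simp add: conjug_def m_assoc)
  ultimately have "conjug G a b \<otimes> inv b = \<one>" using disj by auto
  then have "conjug G a b = b" by (simp add: inv_solve_right')
  then show ?thesis by (simp add: conjug_eq_self_iff)
qed

lemma subgroup_centralizer_in:
  assumes "subgroup K G" "Y \<subseteq> carrier G"
  shows "subgroup {c \<in> K. \<forall>x\<in>Y. c \<otimes> x = x \<otimes> c} G"
proof (rule subgroupI)
  interpret K: subgroup K G by fact
  show "{c \<in> K. \<forall>x\<in>Y. c \<otimes> x = x \<otimes> c} \<subseteq> carrier G" by auto
  have "\<one> \<in> {c \<in> K. \<forall>x\<in>Y. c \<otimes> x = x \<otimes> c}"
    using assms(2) by (auto simp: subset_iff)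
  then show "{c \<in> K. \<forall>x\<in>Y. c \<otimes> x = x \<otimes> c} \<noteq> {}" by blast
  fix a assume a: "a \<in> {c \<in> K. \<forall>x\<in>Y. c \<otimes> x = x \<otimes> c}"
  show "inv a \<in> {c \<in> K. \<forall>x\<in>Y. c \<otimes> x = x \<otimes> c}"
  proof (intro CollectI conjI ballI)
    fix x assume x: "x \<in> Y"
    then have [simp]: "x \<in> carrier G" "a \<in> carrier G" using assms a by auto
    have "conjug G a x = x" using a x by (simp add: conjug_eq_self_iff)
    then have "conjug G (inv a) x = x" by (metis \<open>x \<in> carrier G\<close> \<open>a \<in> carrier G\<close> conjug_inv_cancel(1))
    then show "inv a \<otimes> x = x \<otimes> inv a" by (simp add: conjug_eq_self_iff)
  qed (use a in simp)
  fix b assume b: "b \<in> {c \<in> K. \<forall>x\<in>Y. c \<otimes> x = x \<otimes> c}"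
  show "a \<otimes> b \<in> {c \<in> K. \<forall>x\<in>Y. c \<otimes> x = x \<otimes> c}"
  proof (intro CollectI conjI ballI)
    fix x assume x: "x \<in> Y"
    then have [simp]: "x \<in> carrier G" "a \<in> carrier G" "b \<in> carrier G" using assms a b by auto
    have "conjug G a x = x" "conjug G b x = x" using a b x by (simp_all add: conjug_eq_self_iff)
    then have "conjug G (a \<otimes> b) x = x" by (simp flip: conjug_conjug)
    then show "a \<otimes> b \<otimes> x = x \<otimes> (a \<otimes> b)" by (simp add: conjug_eq_self_iff)
  qed (use a b in simp)
qed

end

text \<open>\<open>T\<close> takes the place of a simple direct factor of \<open>N\<close>. Instead
  of the full decomposition of \<open>N\<close> into simple groups, only the splitting into
  \<open>T\<close> and its centralizer in \<open>N\<close> is derived.\<close>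

locale nonabelian_minimal_normal = group +
  fixes N T :: "'a set"
  assumes fin: "finite (carrier G)"
    and N: "minimal_normal_in G (carrier G) N"
    and T: "minimal_normal_in G N T"
    and nonabelian: "\<exists>a\<in>N. \<exists>b\<in>N. a \<otimes> b \<noteq> b \<otimes> a"
begin

section \<open>Splitting of N into T and its centralizer\<close>

definition cent :: "'a set" where
  "cent = {c \<in> N. \<forall>t\<in>T. c \<otimes> t = t \<otimes> c}"

lemma subgroup_N: "subgroup N G" and N_carrier: "n \<in> N \<Longrightarrow> n \<in> carrier G"
  and N_normal: "\<lbrakk>g \<in> carrier G; n \<in> N\<rbrakk> \<Longrightarrow> conjug G g n \<in> N"
  using N by (auto simp: minimal_normal_in_def normalized_by_def)

lemma N_minimal:
  assumes "subgroup L G" "L \<subseteq> N" "L \<noteq> {\<one>}"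
    "\<And>g l. \<lbrakk>g \<in> carrier G; l \<in> L\<rbrakk> \<Longrightarrow> conjug G g l \<in> L"
  shows "L = N"
  using N assms by (auto simp: minimal_normal_in_def normalized_by_def)

lemma subgroup_T: "subgroup T G" and T_N: "t \<in> T \<Longrightarrow> t \<in> N" and T_nontrivial: "T \<noteq> {\<one>}"
  and T_normal: "\<lbrakk>n \<in> N; t \<in> T\<rbrakk> \<Longrightarrow> conjug G n t \<in> T"
  using T by (auto simp: minimal_normal_in_def normalized_by_def)

lemma T_carrier: "t \<in> T \<Longrightarrow> t \<in> carrier G"
  by (simp add: T_N N_carrier)

lemma T_minimal:
  assumes "subgroup L G" "L \<subseteq> T" "L \<noteq> {\<one>}"
    "\<And>n l. \<lbrakk>n \<in> N; l \<in> L\<rbrakk> \<Longrightarrow> conjug G n l \<in> L"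
  shows "L = T"
  using T assms by (auto simp: minimal_normal_in_def normalized_by_def)

lemma cent_carrier: "c \<in> cent \<Longrightarrow> c \<in> carrier G"
  and cent_commute: "\<lbrakk>c \<in> cent; t \<in> T\<rbrakk> \<Longrightarrow> c \<otimes> t = t \<otimes> c"
  by (auto simp: cent_def N_carrier)

lemma conjug_by_cent: "\<lbrakk>c \<in> cent; t \<in> T\<rbrakk> \<Longrightarrow> conjug G c t = t"
  and conjug_cent_by_T: "\<lbrakk>c \<in> cent; t \<in> T\<rbrakk> \<Longrightarrow> conjug G t c = c"
  using cent_commute[of c t] by (simp_all add: conjug_eq_self_iff cent_carrier T_carrier)

lemma subgroup_cent: "subgroup cent G"
  unfolding cent_def using subgroup_N T_carrier by (intro subgroup_centralizer_in) auto

text \<open>As \<open>N\<close> is normal in \<open>G\<close>, the conjugate of \<open>T\<close> is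
  again normalized by \<open>N\<close>, and so is its intersection with \<open>T\<close>. By
  minimality this intersection is 1 or \<open>T\<close>: in the first case the two subgroups
  commute, in the second they coincide by cardinality.\<close>

lemma conjug_T_cases:
  assumes g: "g \<in> carrier G"
  shows "conjug G g ` T = T \<or> conjug G g ` T \<subseteq> cent"
proof -
  let ?S = "conjug G g ` T"
  have S: "subgroup ?S G" using g subgroup_T by (rule subgroup_conjug_image)
  have S_N: "?S \<subseteq> N" using g N_normal T_N by blast
  have S_norm: "conjug G n s \<in> ?S" if n: "n \<in> N" and s: "s \<in> ?S" for n s
  proof -
    obtain t where t: "t \<in> T" "s = conjug G g t" using s by blast
    have car: "n \<in> carrier G" "t \<in> carrier G" using n t N_carrier T_carrier by auto
    \<comment> \<open>Pull \<open>n\<close> past \<open>g\<close>: it becomes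
      \<open>inv g \<otimes> n \<otimes> g\<close>, which lies in \<open>N\<close> and normalizes
      \<open>T\<close>.\<close>
    have "conjug G n s = conjug G g (conjug G (conjug G (inv g) n) t)"
      using g car t by (simp add: conjug_conjug) (simp add: conjug_def flip: m_assoc)
    moreover have "conjug G (conjug G (inv g) n) t \<in> T"
      using n t g N_normal T_normal by simp
    ultimately show ?thesis by blast
  qed
  have int: "subgroup (T \<inter> ?S) G" using subgroup_T S by (rule subgroups_Inter_pair)
  show ?thesis
  proof (cases "T \<inter> ?S = {\<one>}")
    case True
    have "s \<in> cent" if s: "s \<in> ?S" for s
    proof -
      have "normalized_by G ?S T" using S_N T_normal by (auto simp: normalized_by_def)
      moreover have "normalized_by G T ?S"
        unfolding normalized_by_def using T_N S_norm by blast
      ultimately have "t \<otimes> s = s \<otimes> t" if "t \<in> T" for t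
        using commute_if_normalized_disjoint[OF subgroup_T S] True that s by blast
      then show ?thesis using s S_N unfolding cent_def by fastforce
    qed
    then show ?thesis by blast
  next
    case False
    then have "T \<inter> ?S = T"
      using int S_norm T_normal by (intro T_minimal) auto
    then have "T \<subseteq> ?S" by blast
    moreover have "finite ?S" by (rule finite_subset[OF subgroup.subset[OF S] fin])
    moreover have "card ?S = card T"
      using g T_carrier by (intro card_image inj_on_conjug) auto
    ultimately have "T = ?S" by (metis card_subset_eq)
    then show ?thesis by blast
  qed
qed

text \<open>The \<open>G\<close>-conjugates of \<open>T\<close> generate a nontrivial normal
  subgroup of \<open>G\<close> inside \<open>N\<close>, hence all of \<open>N\<close>. Each
  conjugate lies in \<open>T\<close> or in \<open>cent\<close>, so the generated subgroup stays
  inside the product of these two.\<close>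

lemma N_product:
  assumes n: "n \<in> N"
  obtains t c where "t \<in> T" "c \<in> cent" "n = t \<otimes> c"
proof -
  interpret T: subgroup T G by (rule subgroup_T)
  interpret C: subgroup cent G by (rule subgroup_cent)
  let ?U = "\<Union>g\<in>carrier G. conjug G g ` T" and ?TC = "{t \<otimes> c | t c. t \<in> T \<and> c \<in> cent}"
  have U: "?U \<subseteq> carrier G" by auto
  have "subgroup ?TC G"
  proof (rule subgroupI)
    show "?TC \<subseteq> carrier G" by auto
    show "?TC \<noteq> {}" using T.one_closed C.one_closed by blast
    fix a assume "a \<in> ?TC"
    then obtain t c where a: "a = t \<otimes> c" "t \<in> T" "c \<in> cent" by blast
    have "inv a = inv t \<otimes> inv c"
      using a cent_commute[of c t] inv_mult_group[of c t] by simp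
    then show "inv a \<in> ?TC" using a T.m_inv_closed C.m_inv_closed by blast
    fix b assume "b \<in> ?TC"
    then obtain s d where b: "b = s \<otimes> d" "s \<in> T" "d \<in> cent" by blast
    have "a \<otimes> b = t \<otimes> (c \<otimes> s) \<otimes> d" using a b by (simp add: m_assoc)
    also have "\<dots> = (t \<otimes> s) \<otimes> (c \<otimes> d)" using a b cent_commute[of c s] by (simp add: m_assoc)
    finally show "a \<otimes> b \<in> ?TC" using a b T.m_closed C.m_closed by blast
  qed
  moreover have "?U \<subseteq> ?TC"
  proof
    fix u assume "u \<in> ?U"
    then have "u \<in> T \<or> u \<in> cent" using conjug_T_cases by blast
    moreover have "u = u \<otimes> \<one>" "u = \<one> \<otimes> u" using \<open>u \<in> ?U\<close> U by auto
    ultimately show "u \<in> ?TC" using T.one_closed C.one_closed by blast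
  qed
  ultimately have gen: "generate G ?U \<subseteq> ?TC" by (intro generate_subgroup_incl)
  have "generate G ?U \<lhd> G"
  proof (rule normal_generateI[OF U])
    fix h g assume h: "h \<in> ?U" and g: "g \<in> carrier G"
    then obtain k t where k: "k \<in> carrier G" "t \<in> T" "h = conjug G k t" by blast
    then have "g \<otimes> h \<otimes> inv g = conjug G (g \<otimes> k) t"
      using g by (simp flip: conjug_def add: conjug_conjug)
    then show "g \<otimes> h \<otimes> inv g \<in> ?U" using g k by blast
  qed
  moreover have "generate G ?U \<subseteq> N"
    using N_normal T_N by (intro generate_subgroup_incl[OF _ subgroup_N]) auto
  moreover have "T \<subseteq> generate G ?U"
  proof
    fix t assume "t \<in> T"
    then have "t \<in> ?U" by (intro UN_I[of \<one>] image_eqI[of _ _ t]) auto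
    then show "t \<in> generate G ?U" by (rule generate.incl)
  qed
  ultimately have "generate G ?U = N"
    using T_nontrivial T.one_closed
    by (intro N_minimal) (auto simp: normal_iff_normalized normalized_by_def)
  then show ?thesis using gen n that by blast
qed

text \<open>The center of \<open>T\<close> is normalized by \<open>N\<close>, so if nontrivial it is
  \<open>T\<close>. Then \<open>z\<close> commutes with both \<open>T\<close> and
  \<open>cent\<close>, so it is central in \<open>N\<close>; the center of \<open>N\<close> is
  normal in \<open>G\<close>, hence equals \<open>N\<close>, against noncommutativity.\<close>

lemma center_T_trivial:
  assumes z: "z \<in> T" "\<And>t. t \<in> T \<Longrightarrow> z \<otimes> t = t \<otimes> z"
  shows "z = \<one>"
proof (rule ccontr)
  assume "z \<noteq> \<one>"
  let ?Z = "{z \<in> T. \<forall>t\<in>T. z \<otimes> t = t \<otimes> z}"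
  have center_conj: "conjug G g c \<otimes> x = x \<otimes> conjug G g c"
    if "g \<in> carrier G" "c \<in> carrier G" "x \<in> carrier G"
      "c \<otimes> conjug G (inv g) x = conjug G (inv g) x \<otimes> c" for g c x
    using that by (metis conjug_inv_cancel(2) conjug_mult conjug_closed inv_closed)
  have "?Z = T"
  proof (rule T_minimal)
    show "subgroup ?Z G" using subgroup_T T_carrier by (intro subgroup_centralizer_in) auto
    show "?Z \<noteq> {\<one>}" using z \<open>z \<noteq> \<one>\<close> by blast
    fix n l assume n: "n \<in> N" and l: "l \<in> ?Z"
    have "conjug G n l \<otimes> t = t \<otimes> conjug G n l" if "t \<in> T" for t
      using that n l T_normal[of "inv n" t] subgroup_N
      by (intro center_conj) (auto simp: N_carrier T_carrier subgroup.m_inv_closed)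
    then show "conjug G n l \<in> ?Z" using n l T_normal by blast
  qed blast
  then have T_abelian: "\<And>s t. \<lbrakk>s \<in> T; t \<in> T\<rbrakk> \<Longrightarrow> s \<otimes> t = t \<otimes> s" by blast
  let ?W = "{w \<in> N. \<forall>n\<in>N. w \<otimes> n = n \<otimes> w}"
  have "z \<otimes> n = n \<otimes> z" if "n \<in> N" for n
  proof -
    obtain t c where tc: "t \<in> T" "c \<in> cent" "n = t \<otimes> c" by (rule N_product[OF \<open>n \<in> N\<close>])
    note [simp] = T_carrier[OF tc(1)] cent_carrier[OF tc(2)] T_carrier[OF z(1)]
    have "z \<otimes> n = z \<otimes> t \<otimes> c" by (simp add: tc m_assoc)
    also have "\<dots> = t \<otimes> (z \<otimes> c)" by (simp add: z(2)[OF tc(1)] m_assoc)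
    also have "\<dots> = n \<otimes> z" by (simp add: tc cent_commute[OF tc(2) z(1), symmetric] m_assoc)
    finally show ?thesis .
  qed
  then have "z \<in> ?W" using z T_N by blast
  have "?W = N"
  proof (rule N_minimal)
    show "subgroup ?W G" using subgroup_N N_carrier by (intro subgroup_centralizer_in) auto
    show "?W \<noteq> {\<one>}" using \<open>z \<in> ?W\<close> \<open>z \<noteq> \<one>\<close> by blast
    fix g w assume g: "g \<in> carrier G" and w: "w \<in> ?W"
    have "conjug G g w \<otimes> n = n \<otimes> conjug G g w" if "n \<in> N" for n
      using that g w N_normal[of "inv g" n] by (intro center_conj) (auto simp: N_carrier)
    then show "conjug G g w \<in> ?W" using g w N_normal by blast
  qed blast
  then show False using nonabelian by blast
qed

lemma T_cent_disjoint: "\<lbrakk>x \<in> T; x \<in> cent\<rbrakk> \<Longrightarrow> x = \<one>"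
  using center_T_trivial cent_commute by blast

end

subsection \<open>Fixed-point-free elements of finite actions\<close>

text \<open>The arguments run for an abstract faithful action, so that group theory and point images
  stay separate. Permutation groups enter at the end, with the identity as
  \<open>\<phi>\<close>.\<close>

locale finite_faithful_action = faithful_action +
  assumes finite_group: "finite (carrier G)" and finite_points: "finite E"
begin

sublocale group G
  using group_hom group_hom.axioms(1) by blast

definition fpf :: "'a \<Rightarrow> bool" where
  "fpf g \<longleftrightarrow> g \<in> carrier G \<and> (\<forall>x\<in>E. \<phi> g x \<noteq> x)"

text \<open>The existence of two distinct points is kept out of this predicate; it is added in the
  translation to \<open>sharply_2_transitive\<close>.\<close>

definition sharply_2_transitive_action :: bool where
  "sharply_2_transitive_action \<longleftrightarrow>
     (\<forall>x\<in>E. \<forall>y\<in>E. \<forall>x'\<in>E. \<forall>y'\<in>E. x \<noteq> y \<longrightarrow> x' \<noteq> y' \<longrightarrow>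
        (\<exists>!g. g \<in> carrier G \<and> \<phi> g x = x' \<and> \<phi> g y = y'))"

lemma act_closed [simp]: "\<lbrakk>g \<in> carrier G; x \<in> E\<rbrakk> \<Longrightarrow> \<phi> g x \<in> E"
  using element_image by blast

lemma act_one [simp]: "x \<in> E \<Longrightarrow> \<phi> \<one> x = x"
  by (metis id_eq_one restrict_apply')

lemma act_eq_iff [simp]:
  "\<lbrakk>g \<in> carrier G; x \<in> E; y \<in> E\<rbrakk> \<Longrightarrow> \<phi> g x = \<phi> g y \<longleftrightarrow> x = y"
  using inj_prop by (auto simp: inj_on_def)

lemma act_inv: "\<lbrakk>g \<in> carrier G; x \<in> E\<rbrakk> \<Longrightarrow> \<phi> (inv g) (\<phi> g x) = x"
  using orbit_sym_aux by blast

lemma act_conjug: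
  assumes "g \<in> carrier G" "a \<in> carrier G" "x \<in> E"
  shows "\<phi> (conjug G g a) (\<phi> g x) = \<phi> g (\<phi> a x)"
  using assms by (simp add: conjug_def composition_rule act_inv)

lemma fixes_conjug_iff:
  assumes "g \<in> carrier G" "a \<in> carrier G" "x \<in> E"
  shows "\<phi> (conjug G g a) (\<phi> g x) = \<phi> g x \<longleftrightarrow> \<phi> a x = x"
  using assms by (simp add: act_conjug)

lemma eq_one_if_fixes_all:
  assumes "g \<in> carrier G" "\<And>x. x \<in> E \<Longrightarrow> \<phi> g x = x"
  shows "g = \<one>"
proof -
  \<comment> \<open>Elements of \<open>Bij E\<close> have a fixed default value off
    \<open>E\<close>, so fixing all points of \<open>E\<close> determines \<open>\<phi> g\<close> as
    a function.\<close>
  have "\<phi> g \<in> extensional E" using bij_prop0[OF assms(1)] by (simp add: Bij_imp_extensional)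
  then have "\<phi> g = (\<lambda>x\<in>E. x)" using assms(2) by (intro extensionalityI[of _ E]) auto
  then have "\<phi> g = \<phi> \<one>" using id_eq_one by simp
  then show ?thesis using faithful assms(1) by (auto dest: inj_onD)
qed

lemma fpf_conjug:
  assumes "fpf a" "g \<in> carrier G"
  shows "fpf (conjug G g a)"
  unfolding fpf_def
proof (intro conjI ballI)
  fix x assume "x \<in> E"
  then obtain y where "y \<in> E" "x = \<phi> g y" using bij_prop1[OF assms(2)] by metis
  then show "\<phi> (conjug G g a) x \<noteq> x" using assms by (simp add: fpf_def fixes_conjug_iff)
qed (use assms in \<open>simp add: fpf_def\<close>)

text \<open>With n = |E|, the n point stabilizers have order n - 1 and meet trivially, so n (n - 1)
  = 1 + |D| + n (n - 2) and |D| = n - 1. At most n elements conjugate \<open>a\<close> to a given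
  element, so the class of \<open>a\<close> has at least n - 1 elements and fills
  \<open>D\<close>.\<close>

lemma sharply_2_transitive_fpf_conjugate:
  assumes s2t: sharply_2_transitive_action and xy: "x \<in> E" "y \<in> E" "x \<noteq> y"
  shows "\<exists>d. fpf d" and "\<And>a b. \<lbrakk>fpf a; fpf b\<rbrakk> \<Longrightarrow> \<exists>g\<in>carrier G. conjug G g a = b"
proof -
  let ?n = "card E"
  define D where "D = {d. fpf d}"
  have D_sub: "D \<subseteq> carrier G" by (auto simp: D_def fpf_def)
  then have finD: "finite D" using finite_group finite_subset by blast
  have n2: "?n \<ge> 2"
    using card_mono[OF finite_points, of "{x, y}"] xy by simp
  have ex1: "\<exists>!g. g \<in> carrier G \<and> \<phi> g u = u' \<and> \<phi> g v = v'"
    if "u \<in> E" "v \<in> E" "u' \<in> E" "v' \<in> E" "u \<noteq> v" "u' \<noteq> v'" for u v u' v'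
    using s2t that unfolding sharply_2_transitive_action_def by blast
  have two_fixed: "g = \<one>"
    if "g \<in> carrier G" "u \<in> E" "v \<in> E" "u \<noteq> v" "\<phi> g u = u" "\<phi> g v = v" for g u v
    using ex1[of u v u v] that act_one one_closed by metis
  have stab: "card (stabilizer G \<phi> u) = ?n - 1" if u: "u \<in> E" for u
  proof -
    obtain v where v: "v \<in> E" "v \<noteq> u" using xy by metis
    \<comment> \<open>The stabilizer of \<open>u\<close> acts regularly on the remaining
      points.\<close>
    have "bij_betw (\<lambda>g. \<phi> g v) (stabilizer G \<phi> u) (E - {u})"
    proof (rule bij_betw_imageI)
      show "inj_on (\<lambda>g. \<phi> g v) (stabilizer G \<phi> u)"
      proof (rule inj_onI)
        fix g h assume gh: "g \<in> stabilizer G \<phi> u" "h \<in> stabilizer G \<phi> u" "\<phi> g v = \<phi> h v"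
        then have "\<phi> g v \<in> E" "\<phi> g v \<noteq> u"
          using u v act_eq_iff[of g v u] by (auto simp: stabilizer_def)
        then show "g = h" using ex1[of u v u "\<phi> g v"] u v gh unfolding stabilizer_def by fastforce
      qed
      show "(\<lambda>g. \<phi> g v) ` stabilizer G \<phi> u = E - {u}"
      proof
        show "(\<lambda>g. \<phi> g v) ` stabilizer G \<phi> u \<subseteq> E - {u}"
          using u v act_eq_iff[of _ v u] by (auto simp: stabilizer_def)
        show "E - {u} \<subseteq> (\<lambda>g. \<phi> g v) ` stabilizer G \<phi> u"
        proof
          fix w assume "w \<in> E - {u}"
          then obtain g where "g \<in> carrier G" "\<phi> g u = u" "\<phi> g v = w"
            using ex1[of u v u w] u v by auto
          then show "w \<in> (\<lambda>g. \<phi> g v) ` stabilizer G \<phi> u" by (auto simp: stabilizer_def)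
        qed
      qed
    qed
    then show ?thesis using bij_betw_same_card u by fastforce
  qed
  have orb: "orbit G \<phi> x = E"
  proof
    show "orbit G \<phi> x \<subseteq> E" using xy by (auto simp: orbit_def)
    show "E \<subseteq> orbit G \<phi> x"
    proof
      fix w assume w: "w \<in> E"
      obtain v where "v \<in> E" "v \<noteq> w" using xy by metis
      then obtain g where "g \<in> carrier G" "\<phi> g x = w" using ex1[of x y w v] xy w by auto
      then show "w \<in> orbit G \<phi> x" by (auto simp: orbit_def)
    qed
  qed
  have ordG: "card (carrier G) = ?n * (?n - 1)"
    using orbit_stabilizer_theorem[OF xy(1)] stab[OF xy(1)] orb by (simp add: order_def)
  \<comment> \<open>Each element is the identity, a derangement, or a nontrivial element of some
    point stabilizer; by \<open>two_fixed\<close> that stabilizer is unique.\<close>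
  have part: "carrier G = insert \<one> (D \<union> (\<Union>u\<in>E. stabilizer G \<phi> u - {\<one>}))"
    using D_sub by (auto simp: D_def fpf_def stabilizer_def)
  have one_D: "\<one> \<notin> D" using xy by (auto simp: D_def fpf_def)
  have finS: "finite (stabilizer G \<phi> u)" for u
    using finite_group by (simp add: stabilizer_def)
  have "card (\<Union>u\<in>E. stabilizer G \<phi> u - {\<one>}) = (\<Sum>u\<in>E. card (stabilizer G \<phi> u - {\<one>}))"
    using finite_points finS two_fixed
    by (intro card_UN_disjoint) (auto simp: stabilizer_def)
  also have "\<dots> = (\<Sum>u\<in>E. ?n - 2)"
    using stab finS by (intro sum.cong) (auto simp: stabilizer_def)
  finally have cardU: "card (\<Union>u\<in>E. stabilizer G \<phi> u - {\<one>}) = ?n * (?n - 2)" by simp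
  have "card (carrier G) = Suc (card (D \<union> (\<Union>u\<in>E. stabilizer G \<phi> u - {\<one>})))"
    using finD finS finite_points one_D by (subst part) simp
  also have "card (D \<union> (\<Union>u\<in>E. stabilizer G \<phi> u - {\<one>})) = card D + ?n * (?n - 2)"
    unfolding cardU[symmetric] using finD finS finite_points
    by (intro card_Un_disjoint) (auto simp: D_def fpf_def stabilizer_def)
  finally have "?n * (?n - 1) = Suc (card D + ?n * (?n - 2))" using ordG by simp
  \<comment> \<open>Writing n as m + 2 removes the truncated subtractions.\<close>
  moreover obtain m where m: "?n = m + 2" using n2 by (metis le_iff_add add.commute)
  ultimately have cardD: "card D = ?n - 1" by (simp add: m algebra_simps)
  then have "D \<noteq> {}" using n2 by auto
  then show "\<exists>d. fpf d" by (auto simp: D_def)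

  fix a b assume a: "fpf a" and b: "fpf b"
  have aG: "a \<in> carrier G" using a by (simp add: fpf_def)
  let ?cls = "(\<lambda>g. conjug G g a) ` carrier G"
  have cls_D: "?cls \<subseteq> D" using a fpf_conjug by (auto simp: D_def)
  have fiber: "card {g \<in> carrier G. conjug G g a = c} \<le> ?n" if "c \<in> ?cls" for c
  proof -
    \<comment> \<open>An element \<open>g\<close> conjugating \<open>a\<close> to \<open>c\<close>
      sends \<open>\<phi> a x\<close> to \<open>\<phi> c (\<phi> g x)\<close>. So the image of
      \<open>x\<close> fixes the images of two distinct points, and with them
      \<open>g\<close>.\<close>
    have "inj_on (\<lambda>g. \<phi> g x) {g \<in> carrier G. conjug G g a = c}"
    proof (rule inj_onI)
      fix g h assume gh: "g \<in> {g \<in> carrier G. conjug G g a = c}"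
        "h \<in> {g \<in> carrier G. conjug G g a = c}" "\<phi> g x = \<phi> h x"
      then have [simp]: "g \<in> carrier G" "h \<in> carrier G" by auto
      have "\<phi> g (\<phi> a x) = \<phi> h (\<phi> a x)"
        using gh xy aG act_conjug[of g a x] act_conjug[of h a x] by auto
      moreover have "x \<noteq> \<phi> a x" using a xy by (metis fpf_def)
      ultimately show "g = h"
        using ex1[of x "\<phi> a x" "\<phi> g x" "\<phi> g (\<phi> a x)"] gh(3) xy aG
          act_eq_iff[of g x "\<phi> a x"] act_closed \<open>g \<in> carrier G\<close> \<open>h \<in> carrier G\<close> by metis
    qed
    then show ?thesis
      using card_inj_on_le[OF _ _ finite_points] xy
      by (metis (no_types, lifting) act_closed image_subsetI mem_Collect_eq)
  qed
  have "card (carrier G) = (\<Sum>c\<in>?cls. card {g \<in> carrier G. conjug G g a = c})"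
    using sum.image_gen[OF finite_group, of "\<lambda>_. 1::nat" "\<lambda>g. conjug G g a"] by simp
  also have "\<dots> \<le> (\<Sum>c\<in>?cls. ?n)" by (intro sum_mono fiber)
  finally have "?n * (?n - 1) \<le> ?n * card ?cls" using ordG by (simp add: mult.commute)
  then have "card D \<le> card ?cls" using n2 cardD by simp
  then have "?cls = D" using cls_D finD by (metis card_seteq)
  then have "b \<in> ?cls" using b by (simp only: D_def mem_Collect_eq)
  then show "\<exists>g\<in>carrier G. conjug G g a = b" by blast
qed

end

text \<open>Primitivity enters in the form of quasiprimitivity: nontrivial normal subgroups are
  transitive.\<close>

locale quasiprimitive_single_fpf_class = finite_faithful_action +
  assumes normal_transitive:
    "\<lbrakk>K \<lhd> G; K \<noteq> {\<one>}; x \<in> E; y \<in> E\<rbrakk> \<Longrightarrow> \<exists>k\<in>K. \<phi> k x = y"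
    and fpf_conjugate: "\<lbrakk>fpf a; fpf b\<rbrakk> \<Longrightarrow> \<exists>g\<in>carrier G. conjug G g a = b"
begin

text \<open>\<open>N\<close> is regular and its nontrivial elements are exactly the derangements. To
  move (x, y) to (x', y'), conjugate the element of \<open>N\<close> taking x to y into the one
  taking x' to y', then correct by a translation in \<open>N\<close>. Uniqueness is
  \<open>two_fixed\<close>.\<close>

lemma sharply_2_transitive_if_abelian_normal:
  assumes N: "N \<lhd> G" "N \<noteq> {\<one>}" and abelian: "\<And>a b. \<lbrakk>a \<in> N; b \<in> N\<rbrakk> \<Longrightarrow> a \<otimes> b = b \<otimes> a"
  shows sharply_2_transitive_action
proof -
  interpret N: normal N G by (rule N)
  have N_trans: "\<exists>k\<in>N. \<phi> k x = y" if "x \<in> E" "y \<in> E" for x y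
    using normal_transitive[OF N that] .
  have N_semireg: "m = \<one>" if m: "m \<in> N" "x \<in> E" "\<phi> m x = x" for m x
  proof (rule eq_one_if_fixes_all)
    fix y assume "y \<in> E"
    then obtain k where k: "k \<in> N" "y = \<phi> k x" using N_trans m by blast
    have "\<phi> m y = \<phi> (m \<otimes> k) x" using k m by (simp add: composition_rule)
    also have "\<dots> = \<phi> (k \<otimes> m) x" using k m abelian by simp
    also have "\<dots> = y" using k m by (simp add: composition_rule)
    finally show "\<phi> m y = y" .
  qed (use m in auto)
  have N_fpf: "fpf m" if "m \<in> N" "m \<noteq> \<one>" for m
    using N_semireg that by (auto simp: fpf_def)
  have fpf_N: "d \<in> N" if "fpf d" for d
  proof -
    obtain m where m: "m \<in> N" "m \<noteq> \<one>" using N(2) N.one_closed by blast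
    then obtain g where "g \<in> carrier G" "conjug G g m = d"
      using fpf_conjugate[OF N_fpf \<open>fpf d\<close>] by blast
    then show ?thesis using m N.inv_op_closed2 by (auto simp: conjug_def)
  qed
  have two_fixed: "h = \<one>"
    if h: "h \<in> carrier G" and xy: "x \<in> E" "y \<in> E" "x \<noteq> y" "\<phi> h x = x" "\<phi> h y = y" for h x y
  proof (rule ccontr)
    assume "h \<noteq> \<one>"
    then have hN: "h \<notin> N" using N_semireg xy by blast
    \<comment> \<open>All elements of the coset \<open>N h\<close> have fixed points, so \<open>|E| = |N|\<close> leaves exactly one for each.\<close>
    have "\<exists>m\<in>N. \<phi> m (\<phi> h z) = z" if "z \<in> E" for z using N_trans h that by simp
    \<comment> \<open>\<open>f z\<close> is the only \<open>m\<close> in \<open>N\<close> for which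
      \<open>m \<otimes> h\<close> fixes \<open>z\<close>; uniqueness is
      \<open>f_eq\<close>.\<close>
    then obtain f where f: "\<And>z. z \<in> E \<Longrightarrow> f z \<in> N \<and> \<phi> (f z) (\<phi> h z) = z" by metis
    have f_eq: "f z = m" if "m \<in> N" "z \<in> E" "\<phi> m (\<phi> h z) = z" for m z
    proof -
      have "\<phi> (inv m \<otimes> f z) (\<phi> h z) = \<phi> h z"
        using f[OF that(2)] that h act_inv[of m "\<phi> h z"] by (simp add: composition_rule)
      then have "inv m \<otimes> f z = \<one>"
        using f[OF that(2)] that h by (intro N_semireg[of _ "\<phi> h z"]) auto
      then show ?thesis using f[OF that(2)] that(1)
        by (metis N.mem_carrier inv_closed inv_equality inv_inv)
    qed
    have "N \<subseteq> f ` E"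
    proof
      fix m assume m: "m \<in> N"
      \<comment> \<open>Derangements lie in \<open>N\<close>, so an element outside \<open>N\<close>
        has a fixed point.\<close>
      have "m \<otimes> h \<notin> N"
      proof
        assume "m \<otimes> h \<in> N"
        then have "inv m \<otimes> (m \<otimes> h) \<in> N" using m by simp
        then show False using hN m h by (simp flip: m_assoc)
      qed
      then have "\<not> fpf (m \<otimes> h)" using fpf_N by blast
      then obtain z where z: "z \<in> E" "\<phi> (m \<otimes> h) z = z" using m h by (auto simp: fpf_def)
      then have "f z = m" using m h by (intro f_eq) (simp_all add: composition_rule)
      then show "m \<in> f ` E" using z by blast
    qed
    moreover have "card E \<le> card N"
    proof (rule surj_card_le)
      show "finite N" using finite_subset[OF N.subset finite_group] .
      show "E \<subseteq> (\<lambda>k. \<phi> k x) ` N" using N_trans xy by blast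
    qed
    moreover have "card (f ` E) \<le> card E" using finite_points by (rule card_image_le)
    moreover have "card N \<le> card (f ` E)"
      using \<open>N \<subseteq> f ` E\<close> finite_points by (intro card_mono) auto
    \<comment> \<open>The bounds |E| \<le> |N| \<le> |f(E)| \<le> |E| make \<open>f\<close>
      injective, yet \<open>h\<close> fixes both \<open>x\<close> and \<open>y\<close>, so
      \<open>f\<close> takes the value 1 twice.\<close>
    ultimately have "inj_on f E" using finite_points by (intro eq_card_imp_inj_on) auto
    moreover have "f x = \<one>" "f y = \<one>" using xy by (auto intro!: f_eq)
    ultimately show False using inj_onD[of f E x y] xy by simp
  qed
  show ?thesis
    unfolding sharply_2_transitive_action_def
  proof (intro ballI impI)
    fix x y x' y' assume E: "x \<in> E" "y \<in> E" "x' \<in> E" "y' \<in> E" and ne: "x \<noteq> y" "x' \<noteq> y'"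
    obtain n where n: "n \<in> N" "\<phi> n x = y" using N_trans E by blast
    obtain n' where n': "n' \<in> N" "\<phi> n' x' = y'" using N_trans E by blast
    have "n \<noteq> \<one>" "n' \<noteq> \<one>" using n n' E ne by auto
    then obtain g where g: "g \<in> carrier G" "conjug G g n = n'"
      using fpf_conjugate[OF N_fpf N_fpf] n n' by blast
    \<comment> \<open>The translation \<open>m\<close> corrects the image of \<open>x\<close> and
      keeps the conjugate equal to \<open>n'\<close>, because \<open>N\<close> is abelian.\<close>
    obtain m where m: "m \<in> N" "\<phi> m (\<phi> g x) = x'" using N_trans g E by (meson act_closed)
    have "conjug G (m \<otimes> g) n = conjug G m n'" using g n m by (simp flip: conjug_conjug)
    also have "\<dots> = n'" using m n' abelian by (simp add: conjug_eq_self_iff)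
    finally have mg: "conjug G (m \<otimes> g) n = n'" .
    have fx: "\<phi> (m \<otimes> g) x = x'" using m g E by (simp add: composition_rule)
    have fy: "\<phi> (m \<otimes> g) y = y'"
      using act_conjug[of "m \<otimes> g" n x] mg fx n n' m g E by simp
    show "\<exists>!g. g \<in> carrier G \<and> \<phi> g x = x' \<and> \<phi> g y = y'"
    proof (rule ex1I[of _ "m \<otimes> g"])
      show "m \<otimes> g \<in> carrier G \<and> \<phi> (m \<otimes> g) x = x' \<and> \<phi> (m \<otimes> g) y = y'"
        using fx fy m g by simp
      fix h assume h: "h \<in> carrier G \<and> \<phi> h x = x' \<and> \<phi> h y = y'"
      have car: "m \<otimes> g \<in> carrier G" using m g by simp
      have "\<phi> (inv (m \<otimes> g)) x' = x" "\<phi> (inv (m \<otimes> g)) y' = y"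
        using act_inv[OF car] E fx fy by metis+
      then have "inv (m \<otimes> g) \<otimes> h = \<one>"
        using h car E ne by (intro two_fixed[of _ x y]) (simp_all add: composition_rule)
      then show "h = m \<otimes> g" using h car by (metis inv_closed inv_equality inv_inv)
    qed
  qed
qed

lemma semiregular_subgroup_center:
  assumes T: "subgroup T G" "T \<noteq> {\<one>}"
    and semireg: "\<And>t x. \<lbrakk>t \<in> T; x \<in> E; \<phi> t x = x\<rbrakk> \<Longrightarrow> t = \<one>"
  obtains z where "z \<in> T" "z \<noteq> \<one>" "\<And>t. t \<in> T \<Longrightarrow> t \<otimes> z = z \<otimes> t"
proof -
  interpret T: subgroup T G by (rule T)
  interpret TG: group "G\<lparr>carrier := T\<rparr>" by (rule T.subgroup_is_group[OF is_group])
  have "\<exists>z\<in>T. z \<noteq> \<one> \<and> (\<forall>t\<in>T. t \<otimes> z = z \<otimes> t)"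
  proof (rule TG.equal_orders_center)
    show "finite (carrier (G\<lparr>carrier := T\<rparr>))" using finite_subset[OF T.subset finite_group] by simp
    show "carrier (G\<lparr>carrier := T\<rparr>) \<noteq> {\<one>\<^bsub>G\<lparr>carrier := T\<rparr>\<^esub>}" using T by simp
    fix a b and n :: nat
    assume ab: "a \<in> carrier (G\<lparr>carrier := T\<rparr>)" "b \<in> carrier (G\<lparr>carrier := T\<rparr>)"
      "a \<noteq> \<one>\<^bsub>G\<lparr>carrier := T\<rparr>\<^esub>" "b \<noteq> \<one>\<^bsub>G\<lparr>carrier := T\<rparr>\<^esub>"
      "a [^]\<^bsub>G\<lparr>carrier := T\<rparr>\<^esub> n = \<one>\<^bsub>G\<lparr>carrier := T\<rparr>\<^esub>"
    then have "fpf a" "fpf b" using semireg by (auto simp: fpf_def)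
    then obtain g where g: "g \<in> carrier G" "b = conjug G g a" using fpf_conjugate by metis
    have "a [^] n = \<one>" using ab nat_pow_consistent[of a n T] by simp
    then have "b [^] n = \<one>" using g ab conjug_pow[of g a n] by simp
    then show "b [^]\<^bsub>G\<lparr>carrier := T\<rparr>\<^esub> n = \<one>\<^bsub>G\<lparr>carrier := T\<rparr>\<^esub>"
      using nat_pow_consistent[of b n T] by simp
  next
    fix z assume "z \<in> carrier (G\<lparr>carrier := T\<rparr>)" "z \<noteq> \<one>\<^bsub>G\<lparr>carrier := T\<rparr>\<^esub>"
      "\<And>a. a \<in> carrier (G\<lparr>carrier := T\<rparr>) \<Longrightarrow> a \<otimes>\<^bsub>G\<lparr>carrier := T\<rparr>\<^esub> z = z \<otimes>\<^bsub>G\<lparr>carrier := T\<rparr>\<^esub> a"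
    then show ?thesis by auto
  qed
  then show ?thesis using that by blast
qed

text \<open>Two of the four branches below make \<open>T\<close> semiregular, which
  \<open>not_semireg\<close> excludes because \<open>T\<close> has trivial center. The other two
  contradict \<open>not_as\<close> and the conjugacy of all derangements.\<close>

lemma minimal_normal_abelian:
  assumes not_as: "\<not> almost_simple G" and pt: "x \<in> E"
    and N: "minimal_normal_in G (carrier G) N" and ab: "a \<in> N" "b \<in> N"
  shows "a \<otimes> b = b \<otimes> a"
proof (rule ccontr)
  assume noncomm: "a \<otimes> b \<noteq> b \<otimes> a"
  have "subgroup N G" "N \<noteq> {\<one>}" using N by (auto simp: minimal_normal_in_def)
  then obtain T where T: "minimal_normal_in G N T"
    using minimal_normal_in_exists[OF finite_group] by blast
  interpret nonabelian_minimal_normal G N T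
    using finite_group N T ab noncomm by unfold_locales blast+
  interpret N: subgroup N G by (rule subgroup_N)
  interpret T: subgroup T G by (rule subgroup_T)
  interpret C: subgroup cent G by (rule subgroup_cent)
  have N_normal_G: "N \<lhd> G"
    using N by (simp add: minimal_normal_in_def normal_iff_normalized)
  have N_trans: "\<exists>n\<in>N. \<phi> n u = v" if "u \<in> E" "v \<in> E" for u v
    using normal_transitive[OF N_normal_G \<open>N \<noteq> {\<one>}\<close> that] .
  have not_semireg: False if "\<And>t u. \<lbrakk>t \<in> T; u \<in> E; \<phi> t u = u\<rbrakk> \<Longrightarrow> t = \<one>"
    by (rule semiregular_subgroup_center[OF subgroup_T T_nontrivial])
      (use that center_T_trivial in metis)+
  show False
  proof (cases "cent = {\<one>}")
    case True
    have "T = N"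
    proof
      show "N \<subseteq> T"
      proof
        fix n assume "n \<in> N"
        then obtain t c where tc: "t \<in> T" "c \<in> cent" "n = t \<otimes> c" by (rule N_product)
        then show "n \<in> T" using True by simp
      qed
    qed (use T_N in blast)
    \<comment> \<open>The centralizer of \<open>N\<close> in \<open>G\<close> decides: if trivial,
      the simple group \<open>N\<close> makes \<open>G\<close> almost simple; otherwise it is a
      transitive normal subgroup commuting with \<open>T\<close>.\<close>
    let ?Z = "{g \<in> carrier G. \<forall>n\<in>N. g \<otimes> n = n \<otimes> g}"
    show False
    proof (cases "?Z = {\<one>}")
      case True
      interpret TG: group "G\<lparr>carrier := N\<rparr>" by (rule N.subgroup_is_group[OF is_group])
      have "simple_group (G\<lparr>carrier := N\<rparr>)"
      proof (unfold_locales)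
        have "N \<noteq> {\<one>}" by fact
        moreover have "finite N" using finite_subset[OF N.subset finite_group] .
        ultimately have "card N \<noteq> 1" "card N \<noteq> 0"
          using N.one_closed by (metis card_1_singletonE singletonD, metis card_0_eq empty_iff)
        then show "1 < order (G\<lparr>carrier := N\<rparr>)" by (simp add: order_def)
        fix H assume H: "H \<lhd> G\<lparr>carrier := N\<rparr>"
        have HN: "H \<subseteq> N" using normal_imp_subgroup[OF H] subgroup.subset by fastforce
        have H_sub: "subgroup H G"
          using incl_subgroup[OF subgroup_N normal_imp_subgroup[OF H]] .
        \<comment> \<open>A normal subgroup of \<open>N\<close> is normalized by \<open>N\<close>,
          so minimality of \<open>T = N\<close> gives simplicity.\<close>
        have "H = T" if "H \<noteq> {\<one>}"
        proof (rule T_minimal[OF H_sub _ that])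
          show "H \<subseteq> T" using HN \<open>T = N\<close> by simp
          fix n l assume "n \<in> N" "l \<in> H"
          then show "conjug G n l \<in> H"
            using TG.normal_invE(2)[OF H, of n l] subgroup_N by (simp add: conjug_def)
        qed
        then show "H = carrier (G\<lparr>carrier := N\<rparr>) \<or> H = {\<one>\<^bsub>G\<lparr>carrier := N\<rparr>\<^esub>}"
          using \<open>T = N\<close> by auto
      qed
      moreover have "\<not> comm_group (G\<lparr>carrier := N\<rparr>)"
        using noncomm ab comm_groupE(4)[of "G\<lparr>carrier := N\<rparr>" a b] by auto
      moreover have "\<forall>g\<in>carrier G. (\<forall>n\<in>N. g \<otimes> n = n \<otimes> g) \<longrightarrow> g = \<one>"
        using True by blast
      ultimately have "almost_simple G" unfolding almost_simple_def using N_normal_G by blast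
      then show False using not_as by blast
    next
      case False
      have "?Z \<lhd> G"
        unfolding normal_iff_normalized normalized_by_def
      proof (intro conjI ballI)
        show "subgroup ?Z G" by (intro subgroup_centralizer_in subgroup_self) auto
        fix g z assume g: "g \<in> carrier G" and z: "z \<in> ?Z"
        have "conjug G g z \<otimes> n = n \<otimes> conjug G g z" if n: "n \<in> N" for n
        proof -
          have "conjug G (inv g) n \<in> N" using N_normal g n by simp
          then have "z \<otimes> conjug G (inv g) n = conjug G (inv g) n \<otimes> z" using z by blast
          then have "conjug G g (z \<otimes> conjug G (inv g) n) = conjug G g (conjug G (inv g) n \<otimes> z)"
            by simp
          then show ?thesis using g n z by (simp add: conjug_mult)
        qed
        then show "conjug G g z \<in> ?Z" using g z by simp
      qed
      show False
      proof (rule not_semireg)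
        fix t u assume t: "t \<in> T" "u \<in> E" "\<phi> t u = u"
        show "t = \<one>"
        proof (rule eq_one_if_fixes_all)
          \<comment> \<open>An element that fixes \<open>u\<close> and commutes with a transitive
            group fixes every point.\<close>
          fix v assume "v \<in> E"
          then obtain z where z: "z \<in> ?Z" "\<phi> z u = v"
            using normal_transitive[OF \<open>?Z \<lhd> G\<close> False t(2)] by blast
          have "z \<otimes> t = t \<otimes> z" using z T_N t by blast
          then show "\<phi> t v = v"
            using z t composition_rule[of u z t] composition_rule[of u t z] by simp
        qed (use t in simp)
      qed
    qed
  next
    case False
    \<comment> \<open>The projection to \<open>T\<close> of the stabilizer of \<open>x\<close> in
      \<open>N\<close>.\<close>
    define R where "R = {t \<in> T. \<exists>c\<in>cent. \<phi> (t \<otimes> c) x = x}"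
    have prod: "(s \<otimes> d) \<otimes> (t \<otimes> c) = (s \<otimes> t) \<otimes> (d \<otimes> c)"
      if "s \<in> T" "t \<in> T" "d \<in> cent" "c \<in> cent" for s t c d
    proof -
      have "(s \<otimes> d) \<otimes> (t \<otimes> c) = s \<otimes> (d \<otimes> t) \<otimes> c" using that by (simp add: m_assoc)
      also have "\<dots> = s \<otimes> (t \<otimes> d) \<otimes> c" using cent_commute[of d t] that by simp
      finally show ?thesis using that by (simp add: m_assoc)
    qed
    have R: "subgroup R G"
    proof (rule subgroupI)
      show "R \<subseteq> carrier G" by (auto simp: R_def)
      have "\<one> \<in> R" using pt by (auto simp: R_def intro!: bexI[of _ \<one>])
      then show "R \<noteq> {}" by blast
      fix r assume "r \<in> R"
      then obtain c where r: "r \<in> T" "c \<in> cent" "\<phi> (r \<otimes> c) x = x" by (auto simp: R_def)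
      have "inv r \<otimes> inv c = inv (r \<otimes> c)"
        using r cent_commute[of c r] inv_mult_group[of c r] by simp
      then have "\<phi> (inv r \<otimes> inv c) x = x"
        using r pt act_inv[of "r \<otimes> c" x] by simp
      then show "inv r \<in> R" using r by (auto simp: R_def)
      fix s assume "s \<in> R"
      then obtain d where s: "s \<in> T" "d \<in> cent" "\<phi> (s \<otimes> d) x = x" by (auto simp: R_def)
      have "\<phi> ((r \<otimes> s) \<otimes> (c \<otimes> d)) x = x"
        using r s pt prod[of r s c d] composition_rule[of x "r \<otimes> c" "s \<otimes> d"] by simp
      then show "r \<otimes> s \<in> R" using r s by (auto simp: R_def)
    qed
    show False
    proof (cases "R = T")
      case True
      let ?S = "T \<inter> stabilizer G \<phi> x"
      have "subgroup ?S G"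
        using subgroup_T stabilizer_subgroup[OF pt] by (rule subgroups_Inter_pair)
      have S_norm: "conjug G n s \<in> ?S" if n: "n \<in> N" and s: "s \<in> ?S" for n s
      proof -
        obtain t c where tc: "t \<in> T" "c \<in> cent" "n = t \<otimes> c" using n by (rule N_product)
        \<comment> \<open>Since \<open>R = T\<close>, some \<open>t \<otimes> d\<close> fixes
          \<open>x\<close>. Both \<open>c\<close> and \<open>d\<close> centralize \<open>T\<close>,
          so \<open>n\<close> and \<open>t \<otimes> d\<close> conjugate \<open>s\<close> in the
          same way.\<close>
        obtain d where d: "d \<in> cent" "\<phi> (t \<otimes> d) x = x" using True tc(1) by (auto simp: R_def)
        have "conjug G n s = conjug G t (conjug G c s)" using tc s by (simp add: conjug_conjug)
        also have "conjug G c s = conjug G d s"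
          using tc d s by (simp add: conjug_by_cent)
        also have "conjug G t (conjug G d s) = conjug G (t \<otimes> d) s"
          using tc s d by (simp add: conjug_conjug)
        finally have eq: "conjug G n s = conjug G (t \<otimes> d) s" .
        have "\<phi> (conjug G (t \<otimes> d) s) x = x"
          using fixes_conjug_iff[of "t \<otimes> d" s x] d tc s pt by (simp add: stabilizer_def)
        then show ?thesis using eq T_normal[of n s] n s by (simp add: stabilizer_def)
      qed
      have "?S = {\<one>}"
      proof (rule ccontr)
        assume "?S \<noteq> {\<one>}"
        \<comment> \<open>Now \<open>T\<close> fixes \<open>x\<close>; being normalized by the
          transitive \<open>N\<close>, it fixes every point and is trivial.\<close>
        then have "?S = T" using \<open>subgroup ?S G\<close> S_norm by (intro T_minimal) auto
        show False
        proof -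
          have "t = \<one>" if t: "t \<in> T" for t
          proof (rule eq_one_if_fixes_all)
            fix v assume "v \<in> E"
            then obtain n where n: "n \<in> N" "\<phi> n x = v" using N_trans pt by blast
            have "conjug G (inv n) t \<in> ?S" using \<open>?S = T\<close> T_normal n t by simp
            then have "\<phi> (conjug G n (conjug G (inv n) t)) (\<phi> n x) = \<phi> n x"
              using n t pt by (subst fixes_conjug_iff) (auto simp: stabilizer_def)
            then show "\<phi> t v = v" using n t by simp
          qed (use t in simp)
          then show False using T_nontrivial T.one_closed by blast
        qed
      qed
      show False
      proof (rule not_semireg)
        fix t u assume t: "t \<in> T" "u \<in> E" "\<phi> t u = u"
        obtain n where n: "n \<in> N" "\<phi> n u = x" using N_trans pt t by blast
        have "\<phi> (conjug G n t) x = x" using n t fixes_conjug_iff[of n t u] by simp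
        then have "conjug G n t \<in> ?S" using T_normal n t by (simp add: stabilizer_def)
        then have "conjug G n t = \<one>" using \<open>?S = {\<one>}\<close> by blast
        then show "t = \<one>" using n t by simp
      qed
    next
      case R_proper: False
      interpret TG: group "G\<lparr>carrier := T\<rparr>" by (rule T.subgroup_is_group[OF is_group])
      have RT: "subgroup R (G\<lparr>carrier := T\<rparr>)"
        using R subgroup_T by (rule subgroup_incl) (auto simp: R_def)
      have "finite (carrier (G\<lparr>carrier := T\<rparr>))"
        using finite_subset[OF T.subset finite_group] by simp
      moreover have "R \<noteq> carrier (G\<lparr>carrier := T\<rparr>)" using R_proper by simp
      ultimately obtain t where t: "t \<in> carrier (G\<lparr>carrier := T\<rparr>)"
        and "\<And>s. s \<in> carrier (G\<lparr>carrier := T\<rparr>) \<Longrightarrow> conjug (G\<lparr>carrier := T\<rparr>) s t \<notin> R"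
        using TG.conjugates_of_proper_subgroup_not_cover[OF _ RT] by blast
      then have tR: "conjug G s t \<notin> R" if "s \<in> T" for s
        using that subgroup_T by (simp add: conjug_def)
      have t: "t \<in> T" using t by simp
      have "t \<noteq> \<one>" using tR[of \<one>] subgroup.one_closed[OF R] by auto
      \<comment> \<open>Using \<open>N\<close>, move a fixed point of \<open>t \<otimes> c\<close>
        to \<open>x\<close>. The \<open>T\<close>-part of the conjugated element is a
        \<open>T\<close>-conjugate of \<open>t\<close>, and it would lie in
        \<open>R\<close>.\<close>
      have tc_fpf: "fpf (t \<otimes> c)" if c: "c \<in> cent" for c
        unfolding fpf_def
      proof (intro conjI ballI notI)
        fix v assume v: "v \<in> E" "\<phi> (t \<otimes> c) v = v"
        obtain n where n: "n \<in> N" "\<phi> n v = x" using N_trans pt v by blast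
        obtain s d where sd: "s \<in> T" "d \<in> cent" "n = s \<otimes> d" using n(1) by (rule N_product)
        have "\<phi> (conjug G n (t \<otimes> c)) x = x"
          using fixes_conjug_iff[of n "t \<otimes> c" v] n t c v by simp
        also have "conjug G n (t \<otimes> c) = conjug G n t \<otimes> conjug G n c"
          using n t c by (simp add: conjug_mult)
        also have "conjug G n t = conjug G s (conjug G d t)"
          using sd t by (simp add: conjug_conjug)
        also have "conjug G d t = t"
          using sd t by (simp add: conjug_by_cent)
        also have "conjug G n c = conjug G (d \<otimes> s) c"
          using sd cent_commute[of d s] by simp
        also have "\<dots> = conjug G d (conjug G s c)" using sd c by (simp add: conjug_conjug)
        also have "conjug G s c = c"
          using sd c by (simp add: conjug_cent_by_T)
        finally have "\<phi> (conjug G s t \<otimes> conjug G d c) x = x" .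
        moreover have "conjug G d c \<in> cent" using sd c by (simp add: conjug_def)
        moreover have "conjug G s t \<in> T" using sd t by (simp add: conjug_def)
        ultimately have "conjug G s t \<in> R" by (auto simp: R_def)
        then show False using tR sd by blast
      qed (use t c in simp)
      \<comment> \<open>Both \<open>t\<close> and \<open>t \<otimes> c\<close> are derangements. A
        conjugate of \<open>t\<close> lies in \<open>T\<close> or in \<open>cent\<close>, but
        \<open>t \<otimes> c\<close> lies in neither.\<close>
      obtain c where c: "c \<in> cent" "c \<noteq> \<one>" using False C.one_closed by blast
      have "fpf t" using tc_fpf[of \<one>] t by simp
      then obtain g where g: "g \<in> carrier G" "conjug G g t = t \<otimes> c"
        using fpf_conjugate[OF _ tc_fpf[OF c(1)]] by blast
      then have "t \<otimes> c \<in> conjug G g ` T" using t by (metis imageI)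
      then have "t \<otimes> c \<in> T \<or> t \<otimes> c \<in> cent" using conjug_T_cases[OF g(1)] by blast
      then show False
      proof
        assume "t \<otimes> c \<in> T"
        then have "inv t \<otimes> (t \<otimes> c) \<in> T" using t by simp
        then have "c \<in> T" using t c by (simp flip: m_assoc)
        then show False using T_cent_disjoint c by blast
      next
        assume "t \<otimes> c \<in> cent"
        then have "(t \<otimes> c) \<otimes> inv c \<in> cent" using c by simp
        then have "t \<in> cent" using t c by (simp add: m_assoc)
        then show False using T_cent_disjoint t \<open>t \<noteq> \<one>\<close> by blast
      qed
    qed
  qed
qed

theorem sharply_2_transitive_if_not_almost_simple:
  assumes "\<not> almost_simple G" "x \<in> E" "carrier G \<noteq> {\<one>}"
  shows sharply_2_transitive_action
proof -
  obtain N where N: "minimal_normal_in G (carrier G) N"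
    using minimal_normal_in_exists[OF finite_group subgroup_self assms(3)] .
  show ?thesis
  proof (rule sharply_2_transitive_if_abelian_normal)
    show "N \<lhd> G" "N \<noteq> {\<one>}"
      using N by (auto simp: minimal_normal_in_def normal_iff_normalized)
    show "\<And>a b. \<lbrakk>a \<in> N; b \<in> N\<rbrakk> \<Longrightarrow> a \<otimes> b = b \<otimes> a"
      using minimal_normal_abelian[OF assms(1,2) N] .
  qed
qed

end

subsection \<open>Permutation groups\<close>

lemma perm_group_finite_faithful_action:
  assumes "finite \<Omega>" "perm_group \<Omega> G"
  shows "finite_faithful_action (PG \<Omega> G) \<Omega> (\<lambda>g. g)"
proof -
  have G: "subgroup G (BijGroup \<Omega>)" using assms(2) by (simp add: perm_group_def)
  have "group (PG \<Omega> G)" by (rule subgroup.subgroup_is_group[OF G group_BijGroup])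
  moreover have "(\<lambda>g. g) \<in> hom (PG \<Omega> G) (BijGroup \<Omega>)"
    using subgroup.subset[OF G] by (auto simp: hom_def)
  ultimately have "group_action (PG \<Omega> G) \<Omega> (\<lambda>g. g)"
    unfolding group_action_def group_hom_def group_hom_axioms_def using group_BijGroup by blast
  moreover have "finite G"
  proof (rule finite_subset)
    \<comment> \<open>Finiteness of \<open>G\<close> rests on extensionality: its elements are
      determined by their values on the finite set \<Omega>.\<close>
    show "G \<subseteq> \<Omega> \<rightarrow>\<^sub>E \<Omega>"
    proof
      fix g assume "g \<in> G"
      then have "g \<in> Bij \<Omega>" using subgroup.subset[OF G] by (auto simp: BijGroup_def)
      then show "g \<in> \<Omega> \<rightarrow>\<^sub>E \<Omega>"
        unfolding PiE_def by (intro IntI Bij_imp_funcset Bij_imp_extensional)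
    qed
    show "finite (\<Omega> \<rightarrow>\<^sub>E \<Omega>)" using assms(1) by (simp add: finite_PiE)
  qed
  ultimately show ?thesis
    using assms(1)
    by (auto simp: finite_faithful_action_def faithful_action_def faithful_action_axioms_def
        finite_faithful_action_axioms_def)
qed

section \<open>Classes of derangements and normal subgroups of primitive groups\<close>

lemma conj_class_eq: "conj_class G a = (\<lambda>g. conjug G g a) ` carrier G"
  by (auto simp: conj_class_def conjug_def)

text \<open>Fixing no point is invariant under conjugation, so the sets counted by
  \<open>kappa\<close> are exactly the classes of single derangements.\<close>

lemma kappa_eq_1_iff:
  assumes fa: "finite_faithful_action (PG \<Omega> G) \<Omega> (\<lambda>g. g)"
  shows "kappa \<Omega> G = 1 \<longleftrightarrow> (\<exists>d\<in>G. derangement \<Omega> d) \<and>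
    (\<forall>a\<in>G. \<forall>b\<in>G. derangement \<Omega> a \<longrightarrow> derangement \<Omega> b \<longrightarrow> (\<exists>g\<in>G. conjug (PG \<Omega> G) g a = b))"
    (is "_ \<longleftrightarrow> ?ex \<and> ?conj")
proof -
  interpret finite_faithful_action "PG \<Omega> G" \<Omega> "\<lambda>g. g" by (rule fa)
  have fpf: "fpf a \<longleftrightarrow> a \<in> G \<and> derangement \<Omega> a" for a
    by (auto simp: fpf_def derangement_def)
  let ?cls = "conj_class (PG \<Omega> G)"
  have self: "a \<in> ?cls a" if "a \<in> G" for a
  proof -
    have "a = conjug (PG \<Omega> G) \<one>\<^bsub>PG \<Omega> G\<^esub> a" using that conjug_by_one[of a] by simp
    then show ?thesis unfolding conj_class_eq using one_closed by (rule image_eqI)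
  qed
  have cls_der: "(\<forall>h\<in>?cls a. derangement \<Omega> h) \<longleftrightarrow> derangement \<Omega> a" if "a \<in> G" for a
  proof
    assume "derangement \<Omega> a"
    then have "fpf h" if "h \<in> ?cls a" for h
      using that \<open>a \<in> G\<close> fpf_conjug[of a] fpf[of a] by (auto simp: conj_class_eq)
    then show "\<forall>h\<in>?cls a. derangement \<Omega> h" using fpf by blast
  qed (use self that in blast)
  have cls_eq: "?cls a = ?cls b \<longleftrightarrow> (\<exists>g\<in>G. conjug (PG \<Omega> G) g a = b)" if ab: "a \<in> G" "b \<in> G" for a b
  proof
    assume "?cls a = ?cls b"
    then have "b \<in> ?cls a" using self[OF ab(2)] by simp
    then show "\<exists>g\<in>G. conjug (PG \<Omega> G) g a = b" by (auto simp: conj_class_eq)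
  next
    assume "\<exists>g\<in>G. conjug (PG \<Omega> G) g a = b"
    then obtain g where g: "g \<in> carrier (PG \<Omega> G)" "b = conjug (PG \<Omega> G) g a" by auto
    have incl: "?cls (conjug (PG \<Omega> G) k c) \<subseteq> ?cls c"
      if "k \<in> carrier (PG \<Omega> G)" "c \<in> carrier (PG \<Omega> G)" for k c
    proof
      fix z assume "z \<in> ?cls (conjug (PG \<Omega> G) k c)"
      then obtain h where h: "h \<in> carrier (PG \<Omega> G)" "z = conjug (PG \<Omega> G) h (conjug (PG \<Omega> G) k c)"
        unfolding conj_class_eq by blast
      then have "z = conjug (PG \<Omega> G) (h \<otimes>\<^bsub>PG \<Omega> G\<^esub> k) c" using conjug_conjug that by blast
      then show "z \<in> ?cls c" unfolding conj_class_eq using h that m_closed by blast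
    qed
    have a: "a \<in> carrier (PG \<Omega> G)" using ab by simp
    have "a = conjug (PG \<Omega> G) (inv\<^bsub>PG \<Omega> G\<^esub> g) b" using g a conjug_inv_cancel(1) by metis
    moreover have "b \<in> carrier (PG \<Omega> G)" using ab by simp
    ultimately have "?cls a \<subseteq> ?cls b" using incl[of "inv\<^bsub>PG \<Omega> G\<^esub> g" b] g inv_closed by metis
    moreover have "?cls b \<subseteq> ?cls a" using incl[OF g(1) a] g by simp
    ultimately show "?cls a = ?cls b" by blast
  qed
  have "kappa \<Omega> G = card (?cls ` {d \<in> G. derangement \<Omega> d})"
    unfolding kappa_def using cls_der by (intro arg_cong[where f = card]) blast
  also have "\<dots> = 1 \<longleftrightarrow> ?ex \<and> ?conj"
  proof
    assume "card (?cls ` {d \<in> G. derangement \<Omega> d}) = 1"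
    then obtain K where K: "?cls ` {d \<in> G. derangement \<Omega> d} = {K}" by (rule card_1_singletonE)
    then have "\<And>a. \<lbrakk>a \<in> G; derangement \<Omega> a\<rbrakk> \<Longrightarrow> ?cls a = K" by blast
    then have ?conj using cls_eq by metis
    moreover have ?ex using K by blast
    ultimately show "?ex \<and> ?conj" by blast
  next
    assume *: "?ex \<and> ?conj"
    then obtain d where d: "d \<in> G" "derangement \<Omega> d" by blast
    have "?cls a = ?cls d" if "a \<in> G" "derangement \<Omega> a" for a
      using * cls_eq[OF that(1) d(1)] that d by blast
    then have "?cls ` {d \<in> G. derangement \<Omega> d} = {?cls d}" using d by blast
    then show "card (?cls ` {d \<in> G. derangement \<Omega> d}) = 1" by simp
  qed
  finally show ?thesis .
qed

text \<open>The \<open>K\<close>-orbit of \<open>x\<close> is a block. Were it a single point,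
  normality and transitivity of \<open>G\<close> would make \<open>K\<close> fix every
  point.\<close>

lemma primitive_normal_transitive:
  assumes fa: "finite_faithful_action (PG \<Omega> G) \<Omega> (\<lambda>g. g)" and prim: "primitive \<Omega> G"
    and K: "K \<lhd> PG \<Omega> G" "K \<noteq> {\<one>\<^bsub>PG \<Omega> G\<^esub>}" and xy: "x \<in> \<Omega>" "y \<in> \<Omega>"
  shows "\<exists>k\<in>K. k x = y"
proof -
  interpret finite_faithful_action "PG \<Omega> G" \<Omega> "\<lambda>g. g" by (rule fa)
  interpret K: normal K "PG \<Omega> G" by (rule K)
  let ?B = "(\<lambda>k. k x) ` K"
  have K_conj: "conjug (PG \<Omega> G) g k \<in> K" if "g \<in> carrier (PG \<Omega> G)" "k \<in> K" for g k
    using that K.inv_op_closed2 by (simp add: conjug_def)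
  have img: "g ` ?B \<subseteq> (\<lambda>k. k (g x)) ` K" if g: "g \<in> carrier (PG \<Omega> G)" for g
  proof
    fix z assume "z \<in> g ` ?B"
    then obtain k where k: "k \<in> K" "z = g (k x)" by blast
    then have "z = conjug (PG \<Omega> G) g k (g x)"
      using g xy act_conjug[OF g K.mem_carrier[OF k(1)] xy(1)] by simp
    then show "z \<in> (\<lambda>k. k (g x)) ` K" using K_conj[OF g k(1)] by blast
  qed
  have B_sub: "?B \<subseteq> \<Omega>" using act_closed[OF K.mem_carrier xy(1)] by blast
  have xB: "x \<in> ?B" using K.one_closed act_one[OF xy(1)] by (metis image_eqI)
  have "is_block \<Omega> G ?B"
    unfolding is_block_def
  proof (intro conjI ballI)
    show "?B \<subseteq> \<Omega>" by (rule B_sub)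
    show "?B \<noteq> {}" using xB by blast
    fix g assume "g \<in> G"
    then have g: "g \<in> carrier (PG \<Omega> G)" by simp
    show "g ` ?B = ?B \<or> g ` ?B \<inter> ?B = {}"
    proof (cases "g ` ?B \<inter> ?B = {}")
      case False
      then obtain k l where k: "k \<in> K" and l: "l \<in> K" and eq: "k (g x) = l x" using img[OF g] by force
      have kG: "k \<in> carrier (PG \<Omega> G)" and lG: "l \<in> carrier (PG \<Omega> G)" using K.mem_carrier k l by blast+
      \<comment> \<open>A common point of the block and its image puts \<open>g x\<close> into the
        \<open>K\<close>-orbit of \<open>x\<close>.\<close>
      have gx: "g x = (inv\<^bsub>PG \<Omega> G\<^esub> k \<otimes>\<^bsub>PG \<Omega> G\<^esub> l) x"
        using act_inv[OF kG act_closed[OF g xy(1)]] eq composition_rule[OF xy(1) inv_closed[OF kG] lG] by simp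
      have "g ` ?B \<subseteq> ?B"
      proof
        fix z assume "z \<in> g ` ?B"
        then obtain m where m: "m \<in> K" "z = m (g x)" using img[OF g] by blast
        let ?q = "inv\<^bsub>PG \<Omega> G\<^esub> k \<otimes>\<^bsub>PG \<Omega> G\<^esub> l"
        have q: "?q \<in> K" using k l K.m_closed K.m_inv_closed by blast
        have "z = (m \<otimes>\<^bsub>PG \<Omega> G\<^esub> ?q) x"
          using m gx composition_rule[OF xy(1) K.mem_carrier[OF m(1)] K.mem_carrier[OF q]] by simp
        moreover have "m \<otimes>\<^bsub>PG \<Omega> G\<^esub> ?q \<in> K" using m(1) q by (rule K.m_closed)
        ultimately show "z \<in> ?B" by blast
      qed
      moreover have "card (g ` ?B) = card ?B"
        using inj_on_subset[OF inj_prop[OF g] B_sub] by (rule card_image)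
      moreover have "finite ?B" using finite_subset[OF B_sub finite_points] .
      ultimately show ?thesis by (metis card_subset_eq)
    qed simp
  qed
  then have "card ?B = 1 \<or> ?B = \<Omega>" using prim by (simp add: primitive_def)
  moreover have "card ?B \<noteq> 1"
  proof
    assume "card ?B = 1"
    then have "?B = {x}" using xB by (metis card_1_singletonE singletonD)
    have "k = \<one>\<^bsub>PG \<Omega> G\<^esub>" if k: "k \<in> K" for k
    proof (rule eq_one_if_fixes_all)
      show kG: "k \<in> carrier (PG \<Omega> G)" using K.mem_carrier k by blast
      fix v assume "v \<in> \<Omega>"
      then obtain g where "g \<in> G" and gx: "g x = v"
        using prim xy unfolding primitive_def transitive_on_def by blast
      then have g: "g \<in> carrier (PG \<Omega> G)" by simp
      have "conjug (PG \<Omega> G) (inv\<^bsub>PG \<Omega> G\<^esub> g) k x = x"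
        using K_conj[OF inv_closed[OF g] k] \<open>?B = {x}\<close> by blast
      then have "conjug (PG \<Omega> G) g (conjug (PG \<Omega> G) (inv\<^bsub>PG \<Omega> G\<^esub> g) k) (g x) = g x"
        using fixes_conjug_iff[OF g _ xy(1)] conjug_closed[OF inv_closed[OF g] kG] by blast
      then show "k v = v" using conjug_inv_cancel(2)[OF g kG] gx by simp
    qed
    then show False using K(2) K.one_closed by blast
  qed
  ultimately show ?thesis using xy by blast
qed

theorem theorem2p1:
  fixes \<Omega> :: "'a set" and G :: "('a \<Rightarrow> 'a) set"
  assumes "finite \<Omega>"
    and "perm_group \<Omega> G"
    and "primitive \<Omega> G"
    and "\<not> almost_simple (PG \<Omega> G)"
  shows "kappa \<Omega> G = 1 \<longleftrightarrow> sharply_2_transitive \<Omega> G"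
proof -
  have fa: "finite_faithful_action (PG \<Omega> G) \<Omega> (\<lambda>g. g)"
    using assms(1,2) by (rule perm_group_finite_faithful_action)
  interpret finite_faithful_action "PG \<Omega> G" \<Omega> "\<lambda>g. g" by (rule fa)
  have fpf: "fpf a \<longleftrightarrow> a \<in> G \<and> derangement \<Omega> a" for a
    by (auto simp: fpf_def derangement_def)
  have s2t: "sharply_2_transitive \<Omega> G \<longleftrightarrow>
      (\<exists>x\<in>\<Omega>. \<exists>y\<in>\<Omega>. x \<noteq> y) \<and> sharply_2_transitive_action"
    by (simp add: sharply_2_transitive_def sharply_2_transitive_action_def)
  show ?thesis
  proof
    assume "kappa \<Omega> G = 1"
    then obtain d where d: "d \<in> G" "derangement \<Omega> d"
      and conj: "\<And>a b. \<lbrakk>fpf a; fpf b\<rbrakk> \<Longrightarrow> \<exists>g\<in>carrier (PG \<Omega> G). conjug (PG \<Omega> G) g a = b"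
      unfolding kappa_eq_1_iff[OF fa] fpf by auto
    obtain x where x: "x \<in> \<Omega>" using assms(3) by (auto simp: primitive_def transitive_on_def)
    \<comment> \<open>The derangement itself supplies the second point demanded by
      \<open>sharply_2_transitive\<close>.\<close>
    have dx: "d x \<in> \<Omega>" "d x \<noteq> x" using x d by (auto simp: derangement_def act_closed)
    interpret quasiprimitive_single_fpf_class "PG \<Omega> G" \<Omega> "\<lambda>g. g"
      by unfold_locales (use primitive_normal_transitive[OF fa assms(3)] conj in blast)+
    have "d \<noteq> \<one>\<^bsub>PG \<Omega> G\<^esub>" using act_one[OF x] dx by metis
    then have "carrier (PG \<Omega> G) \<noteq> {\<one>\<^bsub>PG \<Omega> G\<^esub>}" using d by auto
    then have sharply_2_transitive_action
      using assms(4) x by (intro sharply_2_transitive_if_not_almost_simple)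
    then show "sharply_2_transitive \<Omega> G" using s2t x dx by blast
  next
    assume "sharply_2_transitive \<Omega> G"
    then obtain x y where xy: "x \<in> \<Omega>" "y \<in> \<Omega>" "x \<noteq> y" and "sharply_2_transitive_action"
      using s2t by blast
    note sharply_2_transitive_fpf_conjugate[OF this(4) xy]
    then show "kappa \<Omega> G = 1" unfolding kappa_eq_1_iff[OF fa] fpf by auto
  qed
qed

end
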